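(* For all positive integers $m$ and $n$, the graph $LK_{1,m}\cup LK_{1,n}$ is not super edge-magic.
   Context: Graphs are finite and undirected, may contain loops, but multiple edges are not allowed. For integers $m\le n$, $[m,n]=\{m,m+1,\dots,n\}$. $LK_{1,n}$ is the graph obtained from the star $K_{1,n}$ (one central vertex joined to $n$ other vertices) by attaching a loop at its central vertex (for $n=1$: an edge with a loop at one of its two endpoints). $\cup$ denotes disjoint union of graphs. Let $G$ be a graph with $p$ vertices and $q$ edges (loops count as edges). $G$ is edge-magic if there is a bijection $f:V(G)\cup E(G)\to[1,p+q]$ and a constant $k$ such that $f(x)+f(xy)+f(y)=k$ for every edge $xy\in E(G)$ (for a loop, $x=y$). $G$ is super edge-magic if there is such an $f$ with, in addition, $f(V(G))=[1,p]$. It is known that, equivalently, $G$ is super edge-magic if and only if there is a bijection $g:V(G)\to[1,p]$ such that $\{g(u)+g(v):uv\in E(G)\}$ is a set of $q$ consecutive integers (a loop at $u$ contributes $2g(u)$). *)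

theory Defs
  imports Main
begin

text \<open>
  Undirected graphs, possibly with loops but without multiple edges: an edge is the set of its
  end vertices, so an edge joining distinct \<open>x\<close> and \<open>y\<close> is \<open>{x, y}\<close> and a loop at \<open>x\<close> is \<open>{x}\<close>.
\<close>

record 'a lgraph =
  verts :: "'a set"
  edges :: "'a set set"

definition finite_lgraph :: "'a lgraph \<Rightarrow> bool" where
  "finite_lgraph G \<longleftrightarrow>
     finite (verts G) \<and> (\<forall>e\<in>edges G. \<exists>x\<in>verts G. \<exists>y\<in>verts G. e = {x, y})"

definition disjoint_union :: "'a lgraph \<Rightarrow> 'b lgraph \<Rightarrow> ('a + 'b) lgraph" where
  "disjoint_union G H =
     \<lparr>verts = verts G <+> verts H,
      edges = (image Inl) ` edges G \<union> (image Inr) ` edges H\<rparr>"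

text \<open>The star \<open>K\<^sub>1\<^sub>,\<^sub>n\<close> with centre \<open>0\<close> and leaves \<open>1, \<dots>, n\<close>, and a loop at the centre.\<close>

definition LK :: "nat \<Rightarrow> nat lgraph" where
  "LK n = \<lparr>verts = {0..n}, edges = insert {0} ((\<lambda>i. {0, i}) ` {1..n})\<rparr>"

text \<open>
  A total labeling lives on the disjoint union of the vertex set (tagged \<open>Inl\<close>) and the edge
  set (tagged \<open>Inr\<close>). In the magic condition \<open>x = y\<close> is allowed: a loop at \<open>x\<close> counts the label
  of \<open>x\<close> twice.
\<close>

definition edge_magic_labeling :: "'a lgraph \<Rightarrow> ('a + 'a set \<Rightarrow> nat) \<Rightarrow> bool" where
  "edge_magic_labeling G f \<longleftrightarrow>
     bij_betw f (verts G <+> edges G) {1..card (verts G) + card (edges G)} \<and>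
     (\<exists>k. \<forall>x y. {x, y} \<in> edges G \<longrightarrow> f (Inl x) + f (Inr {x, y}) + f (Inl y) = k)"

definition edge_magic :: "'a lgraph \<Rightarrow> bool" where
  "edge_magic G \<longleftrightarrow> (\<exists>f. edge_magic_labeling G f)"

definition super_edge_magic :: "'a lgraph \<Rightarrow> bool" where
  "super_edge_magic G \<longleftrightarrow>
     (\<exists>f. edge_magic_labeling G f \<and> f ` Inl ` verts G = {1..card (verts G)})"

lemma finite_lgraph_LK: "finite_lgraph (LK n)"
proof -
  have "\<exists>x\<in>{0..n}. \<exists>y\<in>{0..n}. {0, i} = {x, y}" if "i \<le> n" for i
    using that by (intro bexI[of _ 0] bexI[of _ i]) simp_all
  from this[of 0] this show ?thesis
    unfolding finite_lgraph_def LK_def by (simp add: ball_Un)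
qed

lemma finite_lgraph_disjoint_union:
  assumes "finite_lgraph G" "finite_lgraph H"
  shows "finite_lgraph (disjoint_union G H)"
proof -
  have "\<exists>x\<in>verts G <+> verts H. \<exists>y\<in>verts G <+> verts H. Inl ` e = {x, y}"
    if e: "e \<in> edges G" for e
  proof -
    from assms(1) e obtain x y where "x \<in> verts G" "y \<in> verts G" "e = {x, y}"
      unfolding finite_lgraph_def by blast
    then show ?thesis
      by (intro bexI[of _ "Inl x"] bexI[of _ "Inl y"]) auto
  qed
  moreover have "\<exists>x\<in>verts G <+> verts H. \<exists>y\<in>verts G <+> verts H. Inr ` e = {x, y}"
    if e: "e \<in> edges H" for e
  proof -
    from assms(2) e obtain x y where "x \<in> verts H" "y \<in> verts H" "e = {x, y}"
      unfolding finite_lgraph_def by blast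
    then show ?thesis
      by (intro bexI[of _ "Inr x"] bexI[of _ "Inr y"]) auto
  qed
  moreover have "finite (verts G <+> verts H)"
    using assms by (simp add: finite_lgraph_def)
  ultimately show ?thesis
    unfolding finite_lgraph_def disjoint_union_def by (simp add: ball_Un)
qed

lemma card_verts_LK: "card (verts (LK n)) = n + 1"
  by (simp add: LK_def)

lemma card_edges_LK: "card (edges (LK n)) = n + 1"
proof -
  have inj: "inj_on (\<lambda>i. {0, i}) {1..n}"
  proof (rule inj_onI)
    fix i j :: nat
    assume "{0, i} = {0, j}"
    then show "i = j"
      unfolding doubleton_eq_iff by blast
  qed
  have "{0} \<noteq> {0, i}" if "i \<in> {1..n}" for i
  proof
    assume "{0} = {0, i}"
    then have "i \<in> {0}" by blast
    with that show False by simp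
  qed
  then have notin: "{0} \<notin> (\<lambda>i. {0, i}) ` {1..n}"
    by blast
  have "finite ((\<lambda>i. {0, i}) ` {1..n})"
    by (rule finite_imageI) (rule finite_atLeastAtMost)
  then have "card (edges (LK n)) = Suc (card ((\<lambda>i. {0, i}) ` {1..n}))"
    unfolding LK_def lgraph.select_convs using notin by (rule card_insert_disjoint)
  also have "\<dots> = Suc (card {1..n})"
    unfolding card_image[OF inj] by (rule refl)
  finally show ?thesis
    by simp
qed

end

theory Submission
  imports Defs
begin

text \<open>
  Let \<open>a\<close> and \<open>b\<close> be the labels of the two centres in a super edge-magic labeling with magic
  constant \<open>k\<close>. The edge labels form an interval, and among them are \<open>k - 2a\<close> and \<open>k - 2b\<close>, the
  labels of the two loops. Their midpoint \<open>k - (a + b)\<close> therefore is an edge label as well, so the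
  labels of the ends of some edge add up to \<open>a + b\<close>
  (\<open>super_edge_magic_loops_edge_sum\<close>). Every edge of the graph contains one of the centres, so the
  other end of this edge carries the label of the other centre and hence is the other centre.
  But no edge joins the two components.
\<close>

text \<open>
  The label set of the edges is the interval above the vertex labels, so it contains the midpoint
  of the labels of any two loops.
\<close>

lemma super_edge_magic_loops_edge_sum:
  assumes fin: "finite_lgraph G"
    and magic: "edge_magic_labeling G f"
    and super: "f ` Inl ` verts G = {1..card (verts G)}"
    and loops: "{x} \<in> edges G" "{y} \<in> edges G"
  shows "\<exists>u\<in>verts G. \<exists>v\<in>verts G. {u, v} \<in> edges G \<and> f (Inl u) + f (Inl v) = f (Inl x) + f (Inl y)"
proof -
  let ?p = "card (verts G)" and ?q = "card (edges G)"
  from magic obtain k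
    where bij: "bij_betw f (verts G <+> edges G) {1..?p + ?q}"
      and k: "\<And>u v. {u, v} \<in> edges G \<Longrightarrow> f (Inl u) + f (Inr {u, v}) + f (Inl v) = k"
    unfolding edge_magic_labeling_def by blast
  have edge_labels: "f ` Inr ` edges G = {?p + 1..?p + ?q}"
  proof -
    have "f ` Inr ` edges G = f ` ((verts G <+> edges G) - Inl ` verts G)"
      by (rule arg_cong[of _ _ "image f"]) auto
    also have "\<dots> = f ` (verts G <+> edges G) - f ` Inl ` verts G"
      using bij by (intro inj_on_image_set_diff[OF bij_betw_imp_inj_on[OF bij]]) auto
    also have "\<dots> = {1..?p + ?q} - {1..?p}"
      using bij super by (simp add: bij_betw_imp_surj_on)
    also have "\<dots> = {?p + 1..?p + ?q}"
      by auto
    finally show ?thesis .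
  qed
  have kx: "f (Inl x) + f (Inr {x}) + f (Inl x) = k" and ky: "f (Inl y) + f (Inr {y}) + f (Inl y) = k"
    using k[of x x] k[of y y] loops by simp_all
  have "f (Inr {x}) \<in> {?p + 1..?p + ?q}" "f (Inr {y}) \<in> {?p + 1..?p + ?q}"
    using loops edge_labels by blast+
  with kx ky have "k - (f (Inl x) + f (Inl y)) \<in> {?p + 1..?p + ?q}"
    by auto
  then obtain e where e: "e \<in> edges G" "f (Inr e) = k - (f (Inl x) + f (Inl y))"
    using edge_labels by (metis (no_types, lifting) imageE)
  with fin obtain u v where uv: "u \<in> verts G" "v \<in> verts G" "e = {u, v}"
    unfolding finite_lgraph_def by blast
  have "f (Inl u) + f (Inl v) = f (Inl x) + f (Inl y)"
    using k[of u v] e uv kx ky by simp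
  with e uv show ?thesis
    by blast
qed

lemma edge_disjoint_union_LK_cases:
  assumes "{u, v} \<in> edges (disjoint_union (LK m) (LK n))"
  obtains i where "{u, v} = {Inl 0, Inl i}" | j where "{u, v} = {Inr 0, Inr j}"
  using assms unfolding disjoint_union_def LK_def by auto

theorem theorem3p1:
  fixes m n :: nat
  assumes "1 \<le> m" and "1 \<le> n"
  shows "\<not> super_edge_magic (disjoint_union (LK m) (LK n))"
proof
  let ?G = "disjoint_union (LK m) (LK n)"
  assume "super_edge_magic ?G"
  then obtain f where magic: "edge_magic_labeling ?G f"
      and super: "f ` Inl ` verts ?G = {1..card (verts ?G)}"
    unfolding super_edge_magic_def by blast
  have fin: "finite_lgraph ?G"
    by (intro finite_lgraph_disjoint_union finite_lgraph_LK)
  have loops: "{Inl 0} \<in> edges ?G" "{Inr 0} \<in> edges ?G"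
    unfolding disjoint_union_def LK_def by simp_all
  have centres: "Inl 0 \<in> verts ?G" "Inr 0 \<in> verts ?G"
    unfolding disjoint_union_def LK_def by auto
  have inj: "u = v" if "f (Inl u) = f (Inl v)" "u \<in> verts ?G" "v \<in> verts ?G" for u v
    using magic that unfolding edge_magic_labeling_def bij_betw_def
    by (metis InlI inj_onD sum.inject(1))
  obtain u v where uv: "u \<in> verts ?G" "v \<in> verts ?G" "{u, v} \<in> edges ?G"
      and sum: "f (Inl u) + f (Inl v) = f (Inl (Inl 0)) + f (Inl (Inr 0))"
    using super_edge_magic_loops_edge_sum[OF fin magic super loops] by blast
  from uv(3) show False
  proof (cases rule: edge_disjoint_union_LK_cases)
    case (1 i)
    with uv sum have "Inl i \<in> verts ?G" "f (Inl (Inl i)) = f (Inl (Inr 0))"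
      by (auto simp: doubleton_eq_iff)
    then show False
      using inj centres by blast
  next
    case (2 j)
    with uv sum have "Inr j \<in> verts ?G" "f (Inl (Inr j)) = f (Inl (Inl 0))"
      by (auto simp: doubleton_eq_iff)
    then show False
      using inj centres by blast
  qed
qed

end
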